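(* Let $a=1+a_2\mathbf{j}+a_3\mathbf{k}$ with $a_2^2+a_3^2=1$, $b=b_1\mathbf{i}+b_2\mathbf{j}+b_3\mathbf{k}\neq0$, $c=c_0+c_1\mathbf{i}+c_2\mathbf{j}+c_3\mathbf{k}$ be split quaternions (all coefficients real) such that $P_{ab}=0$ and $P_{\mathbf{i}a,b}=0$ (these imply $I_b=0$ and $b_1\ne0$). Let $t_1=c_2-c_0a_2-a_3c_1$ and $t_2=c_3-c_0a_3+a_2c_1$. Then $ax^2+bx+c=0$ has a solution $x\in SZ$ if and only if the following condition holds: if $a_2t_1+a_3t_2=0$, then $a_2t_2-a_3t_1-2c_1=0$ and $t_1^2+t_2^2+4b_1^2c_0=0$. If this condition holds, then: (1) If $a_2t_1+a_3t_2\neq0$, the equation has the solution $x=x_0+x_1\mathbf{i}+x_2\mathbf{j}+x_3\mathbf{k}$ with $$x_0=\frac{(a_3t_1-a_2t_2+2c_1)b_1}{2(a_2t_1+a_3t_2)},\qquad x_1=-\frac{t_1^2+t_2^2+2b_1^2(a_2t_1+a_3t_2)+4b_1^2c_0}{4b_1(a_2t_1+a_3t_2)},$$ $$x_2=-a_2x_0-a_3x_1-\frac{t_2}{2b_1},\qquad x_3=-a_3x_0+a_2x_1+\frac{t_1}{2b_1}.$$ (2) If $a_2t_1+a_3t_2=0$, the equation has the solutions $x=x_0+x_1\mathbf{i}+x_2\mathbf{j}+x_3\mathbf{k}$ for all $x_0,x_1\in\mathbb{R}$, where $$x_2=-a_2x_0-a_3x_1-\frac{t_2}{2b_1},\qquad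 x_3=-a_3x_0+a_2x_1+\frac{t_1}{2b_1}.$$
   Context: $\mathbb{H}_s$ is the real algebra of split quaternions $x=x_0+x_1\mathbf{i}+x_2\mathbf{j}+x_3\mathbf{k}$ ($x_i\in\mathbb{R}$), with $\mathbf{i}^2=-1$, $\mathbf{j}^2=\mathbf{k}^2=1$, $\mathbf{i}\mathbf{j}=\mathbf{k}=-\mathbf{j}\mathbf{i}$, $\mathbf{j}\mathbf{k}=-\mathbf{i}=-\mathbf{k}\mathbf{j}$, $\mathbf{k}\mathbf{i}=\mathbf{j}=-\mathbf{i}\mathbf{k}$. Put $I_x=x_0^2+x_1^2-x_2^2-x_3^2$ and $P_{x,y}=P_{xy}=x_0y_0+x_1y_1-x_2y_2-x_3y_3$; $Z(\mathbb{H}_s)=\{x: I_x=0\}$ is the set of zero divisors. In coordinates $P_{ab}=-a_2b_2-a_3b_3$ and $P_{\mathbf{i}a,b}=b_1+a_3b_2-a_2b_3$. For the equation $ax^2+bx+c=0$, $SZ=\{x\in\mathbb{H}_s: ax^2+bx+c=0\text{ and }2x_0a+b\in Z(\mathbb{H}_s)\}$, where $x_0$ is the real part of $x$. *)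

theory Defs
  imports Complex_Main
begin

datatype split_quat =
  SQuat (sq0: real) (sq1: real) (sq2: real) (sq3: real)

lemma split_quat_eq_iff:
  "x = y \<longleftrightarrow> sq0 x = sq0 y \<and> sq1 x = sq1 y \<and> sq2 x = sq2 y \<and> sq3 x = sq3 y"
  by (cases x; cases y) simp

instantiation split_quat :: real_algebra_1
begin

definition "0 = SQuat 0 0 0 0"
definition "1 = SQuat 1 0 0 0"
definition "x + y = SQuat (sq0 x + sq0 y) (sq1 x + sq1 y) (sq2 x + sq2 y) (sq3 x + sq3 y)"
definition "x - y = SQuat (sq0 x - sq0 y) (sq1 x - sq1 y) (sq2 x - sq2 y) (sq3 x - sq3 y)"
definition "- x = SQuat (- sq0 x) (- sq1 x) (- sq2 x) (- sq3 x)"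
definition "r *\<^sub>R x = SQuat (r * sq0 x) (r * sq1 x) (r * sq2 x) (r * sq3 x)"
definition "x * y = SQuat
  (sq0 x * sq0 y - sq1 x * sq1 y + sq2 x * sq2 y + sq3 x * sq3 y)
  (sq0 x * sq1 y + sq1 x * sq0 y - sq2 x * sq3 y + sq3 x * sq2 y)
  (sq0 x * sq2 y + sq2 x * sq0 y - sq1 x * sq3 y + sq3 x * sq1 y)
  (sq0 x * sq3 y + sq3 x * sq0 y + sq1 x * sq2 y - sq2 x * sq1 y)"

instance
  by standard
    (simp_all add: zero_split_quat_def one_split_quat_def plus_split_quat_def
      minus_split_quat_def uminus_split_quat_def scaleR_split_quat_def
      times_split_quat_def split_quat_eq_iff algebra_simps)

end

definition sq_i :: split_quat where "sq_i = SQuat 0 1 0 0"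
definition sq_j :: split_quat where "sq_j = SQuat 0 0 1 0"
definition sq_k :: split_quat where "sq_k = SQuat 0 0 0 1"

lemma split_quat_unit_products:
  "sq_i * sq_i = - 1" "sq_j * sq_j = 1" "sq_k * sq_k = 1"
  "sq_i * sq_j = sq_k" "sq_j * sq_i = - sq_k"
  "sq_j * sq_k = - sq_i" "sq_k * sq_j = sq_i"
  "sq_k * sq_i = sq_j" "sq_i * sq_k = - sq_j"
  by (simp_all add: sq_i_def sq_j_def sq_k_def one_split_quat_def
      uminus_split_quat_def times_split_quat_def)

abbreviation sq_of :: "real \<Rightarrow> real \<Rightarrow> real \<Rightarrow> real \<Rightarrow> split_quat" where
  "sq_of x0 x1 x2 x3 \<equiv>
     of_real x0 + x1 *\<^sub>R sq_i + x2 *\<^sub>R sq_j + x3 *\<^sub>R sq_k"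

lemma sq_of_eq_SQuat: "sq_of x0 x1 x2 x3 = SQuat x0 x1 x2 x3"
  by (simp add: of_real_def sq_i_def sq_j_def sq_k_def one_split_quat_def
      plus_split_quat_def scaleR_split_quat_def)

definition sq_I :: "split_quat \<Rightarrow> real" where
  "sq_I x = (sq0 x)\<^sup>2 + (sq1 x)\<^sup>2 - (sq2 x)\<^sup>2 - (sq3 x)\<^sup>2"

definition sq_P :: "split_quat \<Rightarrow> split_quat \<Rightarrow> real" where
  "sq_P x y = sq0 x * sq0 y + sq1 x * sq1 y - sq2 x * sq2 y - sq3 x * sq3 y"

(* The zero divisors, with 0 included. *)
definition sq_Z :: "split_quat set" where
  "sq_Z = {x. sq_I x = 0}"

definition SZ :: "split_quat \<Rightarrow> split_quat \<Rightarrow> split_quat \<Rightarrow> split_quat set" where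
  "SZ a b c = {x. a * x\<^sup>2 + b * x + c = 0 \<and> (2 * sq0 x) *\<^sub>R a + b \<in> sq_Z}"

end

theory Submission
  imports Defs
begin

text \<open>
  The two orthogonality hypotheses on \<open>b\<close> say precisely that \<open>b\<close> is the multiple \<open>b1 \<i> a\<close> of
  the zero divisor \<open>\<i> a\<close>, where \<open>\<i>\<close> is the first imaginary unit. This has two consequences.

  First, \<open>2 x0 a + b = (2 x0 + b1 \<i>) a\<close> is always a zero divisor, because the form \<open>I\<close> is
  multiplicative and vanishes at \<open>a\<close>. Hence \<open>SZ\<close> is the full solution set.

  Second, the Cayley--Hamilton identity \<open>x\<^sup>2 = 2 x0 x - I x\<close> turns the equation into
  \<open>(2 x0 + b1 \<i>) (a x) - (I x) a + c = 0\<close>. The right ideal generated by \<open>a\<close> is a real plane: if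
  \<open>y1\<close>, \<open>y2\<close> are the last two coordinates of \<open>a x\<close>, then the first two are
  \<open>a2 y1 + a3 y2\<close> and \<open>a3 y1 - a2 y2\<close>. Eliminating between the four coordinates
  of the equation therefore determines \<open>y1\<close> and \<open>y2\<close> outright, namely \<open>y1 = - t2 / (2 b1)\<close> and
  \<open>y2 = t1 / (2 b1)\<close>; these are the formulas for \<open>x2\<close> and \<open>x3\<close>. Once \<open>y1\<close>, \<open>y2\<close> are known,
  \<open>I x\<close> is affine in \<open>x0\<close>, \<open>x1\<close>, and in the real part of the equation its \<open>x0\<close> term cancels
  against that of \<open>2 x0 a x\<close>. The two coordinates that are left thus become one linear
  equation for \<open>x0\<close> and one for \<open>x1\<close>. Both have leading coefficient proportional to \<open>a2 t1 + a3 t2\<close>. If it is nonzero, there is exactly one solution; if it is zero,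
  both equations lose their unknown and become the two consistency conditions, with \<open>x0\<close>,
  \<open>x1\<close> free.
\<close>

lemma sq_I_mult: "sq_I (x * y) = sq_I x * sq_I y"
  by (simp add: sq_I_def times_split_quat_def power2_eq_square algebra_simps)

lemma split_quat_square: "x\<^sup>2 = (2 * sq0 x) *\<^sub>R x - of_real (sq_I x)"
  by (simp add: power2_eq_square of_real_def split_quat_eq_iff sq_I_def times_split_quat_def
      minus_split_quat_def scaleR_split_quat_def one_split_quat_def algebra_simps)

text \<open>
  The vector \<open>(b2, b3)\<close> is orthogonal to the unit vector \<open>(a2, a3)\<close>, and the second
  condition gives its component along \<open>(- a3, a2)\<close> as \<open>b1\<close>.
\<close>

lemma orthogonal_eq_scaled_i_mult:
  assumes a_unit: "a2\<^sup>2 + a3\<^sup>2 = 1"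
    and P_ab: "sq_P (SQuat 1 0 a2 a3) (SQuat 0 b1 b2 b3) = 0"
    and P_iab: "sq_P (sq_i * SQuat 1 0 a2 a3) (SQuat 0 b1 b2 b3) = 0"
  shows "b2 = - a3 * b1" "b3 = a2 * b1"
proof -
  have 1: "a2 * b2 + a3 * b3 = 0"
    using P_ab by (simp add: sq_P_def)
  have 2: "b1 + a3 * b2 - a2 * b3 = 0"
    using P_iab by (simp add: sq_P_def sq_i_def times_split_quat_def)
  show "b2 = - a3 * b1" "b3 = a2 * b1"
    using a_unit 1 2 by algebra+
qed

lemma derivative_in_sq_Z:
  assumes a_unit: "a2\<^sup>2 + a3\<^sup>2 = 1"
  shows "r *\<^sub>R SQuat 1 0 a2 a3 + SQuat 0 b1 (- a3 * b1) (a2 * b1) \<in> sq_Z"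
proof -
  have "r *\<^sub>R SQuat 1 0 a2 a3 + SQuat 0 b1 (- a3 * b1) (a2 * b1)
      = SQuat r b1 0 0 * SQuat 1 0 a2 a3"
    by (simp add: plus_split_quat_def scaleR_split_quat_def times_split_quat_def)
  moreover have "sq_I (SQuat 1 0 a2 a3) = 0"
    using a_unit by (simp add: sq_I_def)
  ultimately show ?thesis
    by (simp add: sq_Z_def sq_I_mult)
qed

text \<open>
  For \<open>z = x0 + x1 \<i>\<close>, \<open>w = x2 + x3 \<i>\<close> and the complex unit \<open>\<alpha> = a2 + a3 \<i>\<close>, the numbers below
  are the parts of \<open>y = w + \<alpha> cnj z\<close> and of \<open>\<alpha> cnj y = p + q \<i>\<close>. The form
  \<open>I x = \<bar>z\<bar>\<^sup>2 - \<bar>w\<bar>\<^sup>2\<close> loses its quadratic part in \<open>z\<close> because \<open>\<bar>\<alpha>\<bar> = 1\<close>.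
\<close>

lemma sq_I_plane_coordinates:
  assumes a_unit: "a2\<^sup>2 + a3\<^sup>2 = 1"
    and y1: "y1 = x2 + a2 * x0 + a3 * x1"
    and y2: "y2 = x3 + a3 * x0 - a2 * x1"
    and p: "p = a2 * y1 + a3 * y2"
    and q: "q = a3 * y1 - a2 * y2"
  shows "SQuat 1 0 a2 a3 * SQuat x0 x1 x2 x3 = SQuat p q y1 y2"
    and "sq_I (SQuat x0 x1 x2 x3) = 2 * (p * x0 + q * x1) - (y1\<^sup>2 + y2\<^sup>2)"
proof -
  have "p = x0 + a2 * x2 + a3 * x3" "q = x1 + a3 * x2 - a2 * x3"
    using a_unit unfolding p q y1 y2 by algebra+
  then show "SQuat 1 0 a2 a3 * SQuat x0 x1 x2 x3 = SQuat p q y1 y2"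
    by (simp add: times_split_quat_def y1 y2)
  show "sq_I (SQuat x0 x1 x2 x3) = 2 * (p * x0 + q * x1) - (y1\<^sup>2 + y2\<^sup>2)"
    using a_unit unfolding p q y1 y2 sq_I_def split_quat.sel by algebra
qed

text \<open>
  Let \<open>e0\<close>, \<dots>, \<open>e3\<close> be the four coordinates of the equation. Then \<open>e2\<close>, \<open>e3\<close> may be replaced by \<open>e2 - a2 e0 - a3 e1\<close> and
  \<open>e3 - a3 e0 + a2 e1\<close>. In complex terms, this subtracts \<open>\<alpha>\<close> times the conjugate of the first half
  of the equation from the second half; the difference of \<open>2 x0 + b1 \<i>\<close> and its conjugate is the
  constant \<open>2 b1 \<i>\<close>, so that \<open>y\<close> is determined without \<open>x0\<close>.
\<close>

lemma solution_iff_linear_system: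
  assumes a_unit: "a2\<^sup>2 + a3\<^sup>2 = 1" and b1: "b1 \<noteq> 0"
    and t1: "t1 = c2 - c0 * a2 - a3 * c1"
    and t2: "t2 = c3 - c0 * a3 + a2 * c1"
    and D: "D = a2 * t1 + a3 * t2"
  shows "SQuat 1 0 a2 a3 * (SQuat x0 x1 x2 x3)\<^sup>2
      + SQuat 0 b1 (- a3 * b1) (a2 * b1) * SQuat x0 x1 x2 x3 + SQuat c0 c1 c2 c3 = 0 \<longleftrightarrow>
    x2 = - a2 * x0 - a3 * x1 - t2 / (2 * b1) \<and>
    x3 = - a3 * x0 + a2 * x1 + t1 / (2 * b1) \<and>
    2 * D * x0 = (a3 * t1 - a2 * t2 + 2 * c1) * b1 \<and>
    4 * b1 * D * x1 = - (t1\<^sup>2 + t2\<^sup>2 + 2 * b1\<^sup>2 * D + 4 * b1\<^sup>2 * c0)"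
    (is "?eq \<longleftrightarrow> ?X2 \<and> ?X3 \<and> ?X0 \<and> ?X1")
proof -
  define y1 where "y1 = x2 + a2 * x0 + a3 * x1"
  define y2 where "y2 = x3 + a3 * x0 - a2 * x1"
  define p where "p = a2 * y1 + a3 * y2"
  define q where "q = a3 * y1 - a2 * y2"
  define N where "N = sq_I (SQuat x0 x1 x2 x3)"
  let ?a = "SQuat 1 0 a2 a3" and ?x = "SQuat x0 x1 x2 x3"
    and ?b = "SQuat 0 b1 (- a3 * b1) (a2 * b1)"
  note plane = sq_I_plane_coordinates[OF a_unit y1_def y2_def p_def q_def]
  have N: "N = 2 * (p * x0 + q * x1) - (y1\<^sup>2 + y2\<^sup>2)"
    using plane(2) by (simp add: N_def)
  have y1_pq: "y1 = a2 * p + a3 * q" and y2_pq: "y2 = a3 * p - a2 * q"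
    using a_unit unfolding p_def q_def by algebra+
  \<comment> \<open>\<open>b = b1 \<i> a\<close>, so both \<open>x\<close>-dependent products are expressed through \<open>a x\<close>.\<close>
  have bx: "?b * ?x = SQuat 0 b1 0 0 * SQuat p q y1 y2"
    unfolding plane(1)[symmetric] mult.assoc[symmetric]
    by (simp add: times_split_quat_def mult.commute)
  have ax: "?a * ?x\<^sup>2 = (2 * x0) *\<^sub>R SQuat p q y1 y2 - N *\<^sub>R ?a"
    unfolding split_quat_square right_diff_distrib
    by (simp add: plane(1) N_def of_real_def)
  have "?eq \<longleftrightarrow> 2 * x0 * p - b1 * q - N + c0 = 0 \<and> 2 * x0 * q + b1 * p + c1 = 0 \<and>
      2 * x0 * y1 - b1 * y2 - N * a2 + c2 = 0 \<and> 2 * x0 * y2 + b1 * y1 - N * a3 + c3 = 0"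
    (is "_ \<longleftrightarrow> ?e0 \<and> ?e1 \<and> ?e2 \<and> ?e3")
    unfolding ax bx
    by (simp add: plus_split_quat_def minus_split_quat_def scaleR_split_quat_def
        times_split_quat_def zero_split_quat_def algebra_simps)
  also have "\<dots> \<longleftrightarrow> ?e0 \<and> ?e1 \<and> t1 = 2 * b1 * y2 \<and> t2 = - 2 * b1 * y1"
  proof -
    have "2 * x0 * y1 - b1 * y2 - N * a2 + c2 =
        a2 * (2 * x0 * p - b1 * q - N + c0) + a3 * (2 * x0 * q + b1 * p + c1)
        + (t1 - 2 * b1 * y2)"
      unfolding t1 y1_pq y2_pq by algebra
    moreover have "2 * x0 * y2 + b1 * y1 - N * a3 + c3 =
        a3 * (2 * x0 * p - b1 * q - N + c0) - a2 * (2 * x0 * q + b1 * p + c1)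
        + (t2 + 2 * b1 * y1)"
      unfolding t2 y1_pq y2_pq by algebra
    ultimately show ?thesis by auto
  qed
  also have "\<dots> \<longleftrightarrow> t1 = 2 * b1 * y2 \<and> t2 = - 2 * b1 * y1 \<and> ?X0 \<and> ?X1"
  proof -
    \<comment> \<open>The \<open>x0\<close> terms \<open>2 x0 p\<close> of \<open>?e0\<close> and of \<open>N\<close> cancel, which is why \<open>?e0\<close> restricts only \<open>x1\<close>.\<close>
    have "?e0 \<longleftrightarrow> ?X1" "?e1 \<longleftrightarrow> ?X0" if y: "t1 = 2 * b1 * y2" "t2 = - 2 * b1 * y1"
    proof -
      have Dq: "D = - 2 * b1 * q" and Ep: "a3 * t1 - a2 * t2 = 2 * b1 * p"
        unfolding D y p_def q_def by algebra+
      have "4 * b1 * D * x1 + (t1\<^sup>2 + t2\<^sup>2 + 2 * b1\<^sup>2 * D + 4 * b1\<^sup>2 * c0)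
          = 4 * b1\<^sup>2 * (2 * x0 * p - b1 * q - N + c0)"
        unfolding Dq N unfolding y by algebra
      moreover have "4 * b1\<^sup>2 * (2 * x0 * p - b1 * q - N + c0) = 0 \<longleftrightarrow> ?e0"
        using b1 by simp
      ultimately show "?e0 \<longleftrightarrow> ?X1" by linarith
      have "(a3 * t1 - a2 * t2 + 2 * c1) * b1 - 2 * D * x0
          = 2 * b1 * (2 * x0 * q + b1 * p + c1)"
        unfolding Dq Ep by algebra
      moreover have "2 * b1 * (2 * x0 * q + b1 * p + c1) = 0 \<longleftrightarrow> ?e1"
        using b1 by simp
      ultimately show "?e1 \<longleftrightarrow> ?X0" by linarith
    qed
    then show ?thesis by blast
  qed
  also have "\<dots> \<longleftrightarrow> ?X2 \<and> ?X3 \<and> ?X0 \<and> ?X1"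
  proof -
    have "t1 = 2 * b1 * y2 \<longleftrightarrow> ?X3" "t2 = - 2 * b1 * y1 \<longleftrightarrow> ?X2"
      using b1 unfolding y1_def y2_def by (auto simp: field_simps)
    then show ?thesis by blast
  qed
  finally show ?thesis .
qed

theorem theorem3p2:
  fixes a b c :: split_quat
    and a2 a3 b1 b2 b3 c0 c1 c2 c3 t1 t2 :: real
    and C :: bool
  assumes a: "a = sq_of 1 0 a2 a3" and a_unit: "a2\<^sup>2 + a3\<^sup>2 = 1"
    and b: "b = sq_of 0 b1 b2 b3" and b_nonzero: "b \<noteq> 0"
    and c: "c = sq_of c0 c1 c2 c3"
    and P_ab: "sq_P a b = 0"
    and P_iab: "sq_P (sq_i * a) b = 0"
    and t1: "t1 = c2 - c0 * a2 - a3 * c1"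
    and t2: "t2 = c3 - c0 * a3 + a2 * c1"
    and C: "C \<longleftrightarrow>
      (a2 * t1 + a3 * t2 = 0 \<longrightarrow>
        a2 * t2 - a3 * t1 - 2 * c1 = 0 \<and> t1\<^sup>2 + t2\<^sup>2 + 4 * b1\<^sup>2 * c0 = 0)"
  shows "sq_I b = 0 \<and> b1 \<noteq> 0 \<and>
    ((\<exists>x. x \<in> SZ a b c) \<longleftrightarrow> C) \<and>
    (C \<longrightarrow>
      (a2 * t1 + a3 * t2 \<noteq> 0 \<longrightarrow>
        (\<forall>x0 x1 x2 x3.
          x0 = (a3 * t1 - a2 * t2 + 2 * c1) * b1 / (2 * (a2 * t1 + a3 * t2)) \<longrightarrow>
          x1 = - ((t1\<^sup>2 + t2\<^sup>2 + 2 * b1\<^sup>2 * (a2 * t1 + a3 * t2) + 4 * b1\<^sup>2 * c0)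
                   / (4 * b1 * (a2 * t1 + a3 * t2))) \<longrightarrow>
          x2 = - a2 * x0 - a3 * x1 - t2 / (2 * b1) \<longrightarrow>
          x3 = - a3 * x0 + a2 * x1 + t1 / (2 * b1) \<longrightarrow>
          SZ a b c = {sq_of x0 x1 x2 x3})) \<and>
      (a2 * t1 + a3 * t2 = 0 \<longrightarrow>
        SZ a b c =
          {sq_of x0 x1 (- a2 * x0 - a3 * x1 - t2 / (2 * b1))
                       (- a3 * x0 + a2 * x1 + t1 / (2 * b1)) | x0 x1. True}))"
proof -
  have a': "a = SQuat 1 0 a2 a3" and b': "b = SQuat 0 b1 b2 b3" and c': "c = SQuat c0 c1 c2 c3"
    using a b c by (simp_all only: sq_of_eq_SQuat)
  have b23: "b2 = - a3 * b1" "b3 = a2 * b1"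
    using orthogonal_eq_scaled_i_mult[OF a_unit P_ab[unfolded a' b'] P_iab[unfolded a' b']] .
  have b1: "b1 \<noteq> 0"
    using b_nonzero unfolding b' b23 by (auto simp: zero_split_quat_def)
  have b_zero_divisor: "sq_I b = 0"
    using derivative_in_sq_Z[OF a_unit, of 0 b1]
    by (simp add: sq_Z_def b' b23)
  define D where "D = a2 * t1 + a3 * t2"
  define E where "E = a3 * t1 - a2 * t2 + 2 * c1"
  define F where "F = t1\<^sup>2 + t2\<^sup>2 + 4 * b1\<^sup>2 * c0"
  define X2 where "X2 x0 x1 = - a2 * x0 - a3 * x1 - t2 / (2 * b1)" for x0 x1
  define X3 where "X3 x0 x1 = - a3 * x0 + a2 * x1 + t1 / (2 * b1)" for x0 x1
  have mem: "SQuat x0 x1 x2 x3 \<in> SZ a b c \<longleftrightarrow> x2 = X2 x0 x1 \<and> x3 = X3 x0 x1 \<and>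
      2 * D * x0 = E * b1 \<and> 4 * b1 * D * x1 = - (F + 2 * b1\<^sup>2 * D)" for x0 x1 x2 x3
    using solution_iff_linear_system[OF a_unit b1 t1 t2 D_def, of x0 x1 x2 x3]
      derivative_in_sq_Z[OF a_unit, of "2 * x0" b1]
    unfolding SZ_def a' b' c' b23 X2_def X3_def E_def F_def by (simp add: algebra_simps)
  have C': "C \<longleftrightarrow> (D = 0 \<longrightarrow> E = 0 \<and> F = 0)"
    unfolding C D_def E_def F_def by auto
  have regular: "SZ a b c = {SQuat x0 x1 (X2 x0 x1) (X3 x0 x1)}"
    if "D \<noteq> 0" and x0: "x0 = E * b1 / (2 * D)"
      and x1: "x1 = - ((F + 2 * b1\<^sup>2 * D) / (4 * b1 * D))" for x0 x1
  proof -
    have "2 * D * u = E * b1 \<longleftrightarrow> u = x0"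
      "4 * b1 * D * u = - (F + 2 * b1\<^sup>2 * D) \<longleftrightarrow> u = x1" for u
      using \<open>D \<noteq> 0\<close> b1 unfolding x0 x1 minus_divide_left
      by (simp_all add: eq_divide_eq mult.commute)
    then have "x \<in> SZ a b c \<longleftrightarrow> x = SQuat x0 x1 (X2 x0 x1) (X3 x0 x1)" for x
      by (cases x) (auto simp: mem)
    then show ?thesis by blast
  qed
  have singular: "SZ a b c = {SQuat x0 x1 (X2 x0 x1) (X3 x0 x1) | x0 x1. True}"
    if "D = 0" "E = 0" "F = 0"
  proof -
    have "x \<in> SZ a b c \<longleftrightarrow> (\<exists>x0 x1. x = SQuat x0 x1 (X2 x0 x1) (X3 x0 x1))" for x
      by (cases x) (auto simp: mem that)
    then show ?thesis by blast
  qed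
  have solvable: "(\<exists>x. x \<in> SZ a b c) \<longleftrightarrow> C"
  proof
    assume "\<exists>x. x \<in> SZ a b c"
    then obtain x0 x1 x2 x3 where "SQuat x0 x1 x2 x3 \<in> SZ a b c"
      by (metis split_quat.exhaust)
    then show C
      using b1 unfolding C' mem by auto
  next
    assume C
    then show "\<exists>x. x \<in> SZ a b c"
      using regular[OF _ refl refl] singular unfolding C' by (cases "D = 0") blast+
  qed
  have F_shift: "t1\<^sup>2 + t2\<^sup>2 + 2 * b1\<^sup>2 * D + 4 * b1\<^sup>2 * c0 = F + 2 * b1\<^sup>2 * D"
    by (simp add: F_def)
  show ?thesis
    unfolding sq_of_eq_SQuat D_def[symmetric] E_def[symmetric] F_shift
      X2_def[symmetric] X3_def[symmetric]
    using b_zero_divisor b1 solvable regular singular C' by blast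
qed

end
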